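(* Let $(s_n)_{n\ge 0}$ be a sequence over $\mathbb{F}_2$ whose generating function $G(x)=\sum_{n\ge0}s_nx^n\in\mathbb{F}_2[[x]]$ satisfies $h(x,G(x))=0$, where \[ h(x,y)=(x+1)^{2^\ell}\big((a_1x+a_0)y^2+y\big)+f(x)\in\mathbb{F}_2[x,y] \] with an integer $\ell\ge 0$, a polynomial $f\in\mathbb{F}_2[x]$ with $\deg f\le 2^\ell-1$, and $a_0,a_1\in\mathbb{F}_2$ with $(a_1,a_0)\ne(0,0)$. Then \[ C_2(s_n,N)>\frac{N}{2^\ell+2}-2\qquad\text{for all } N\ge 2^{\ell+1}+4 . \]
   Context: For a binary sequence $(s_n)$ over $\mathbb{F}_2=\{0,1\}$, the $N$th correlation measure of order $2$ is \[ C_2(s_n,N)=\max_{M,d_1,d_2}\left|\sum_{n=0}^{M}(-1)^{s_{n+d_1}+s_{n+d_2}}\right|, \] where the maximum is taken over all integers $M\ge 0$ and $0\le d_1<d_2$ with $d_2+M<N$. *)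

theory Defs
  imports
    Complex_Main
    "HOL-Library.Z2"
    "HOL-Computational_Algebra.Polynomial_FPS"
begin

text \<open>
  The field with two elements is \<^typ>\<open>bit\<close>. The exponent of \<open>-1\<close> below is the sum taken in this
  field and then read as the natural number 0 or 1.

  The maximum ranges over a finite set, which is nonempty exactly if \<open>N \<ge> 2\<close>; for smaller \<open>N\<close>
  the value is unspecified.
\<close>

definition correlation_measure2 :: "(nat \<Rightarrow> bit) \<Rightarrow> nat \<Rightarrow> int" where
  "correlation_measure2 s N =
     Max {\<bar>\<Sum>n = 0..M. (-1) ^ of_bit (s (n + d1) + s (n + d2))\<bar> | M d1 d2.
            d1 < d2 \<and> d2 + M < N}"

text \<open>
  An element of \<open>R[x,y]\<close> is represented in \<open>R[x][y]\<close>, i.e. the outer polynomial variable is \<open>y\<close>.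
  The following is the value \<open>p(x, G(x))\<close> in \<open>R[[x]]\<close>.
\<close>

definition eval_at_fps :: "'a::comm_ring_1 poly poly \<Rightarrow> 'a fps \<Rightarrow> 'a fps" where
  "eval_at_fps p G = poly (map_poly fps_of_poly p) G"

definition h_poly :: "nat \<Rightarrow> bit \<Rightarrow> bit \<Rightarrow> bit poly \<Rightarrow> bit poly poly" where
  "h_poly l a1 a0 f =
     (let x = [:[:0, 1:]:]; y = [:0, 1:]
      in (x + 1) ^ (2 ^ l) * (([:[:a1:]:] * x + [:[:a0:]:]) * y ^ 2 + y) + [:f:])"

end

theory Submission
  imports Defs
begin

unbundle fps_syntax

text \<open>
  Put \<open>q = 2\<^sup>l\<close>. In characteristic 2 the equation says that \<open>T = (a1 x + a0) G\<^sup>2 + G\<close> equals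
  \<open>f / (1 + x\<^sup>q)\<close>, so the coefficients \<open>t\<close> of \<open>T\<close> have period \<open>q\<close>, and
  \<open>s (2m + b) = t (2m + b) + a_b s m\<close> for \<open>b = 0, 1\<close>.
  A shift by a multiple of \<open>q\<close> cancels \<open>t\<close>: if \<open>q dvd 2d\<close>, then
  \<open>w' (2m + b) = a_b w m\<close> for the differences \<open>w n = s n + s (n + d)\<close> and
  \<open>w' n = s n + s (n + 2d)\<close>.
  Starting from \<open>d = q/2\<close> and doubling \<open>j\<close> times, one gets a difference sequence that is constant
  on \<open>{..<2\<^sup>j}\<close> up to at most one exception. Choosing \<open>j\<close> with
  \<open>2\<^sup>j (q/2 + 1) \<le> N < 2\<^sup>j (q + 2)\<close> gives the bound \<open>2\<^sup>j - 2\<close>.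
  For \<open>q = 1\<close> there is no half period to start from; then \<open>t\<close> is constant, and either \<open>a0 = 1\<close> and
  \<open>s\<close> is constant from index 1 on, or \<open>s n + s (n + 4)\<close> vanishes unless \<open>n mod 4 = 3\<close>.
\<close>

subsection \<open>The functional equation\<close>

lemma bit_fps_add_self: "(F :: bit fps) + F = 0"
proof (rule fps_ext)
  show "(F + F) $ n = 0 $ n" for n
    by (cases "F $ n") (simp_all only: fps_add_nth fps_zero_nth, simp_all)
qed

lemma bit_fps_two_eq_0: "(2 :: bit fps) = 0"
  using bit_fps_add_self[of 1] by simp

lemma bit_fps_one_plus_X_power:
  "(1 + fps_X :: bit fps) ^ (2 ^ l) = 1 + fps_X ^ (2 ^ l)"
proof (induction l)
  case (Suc l)
  have "(1 + fps_X :: bit fps) ^ (2 ^ Suc l) = ((1 + fps_X) ^ (2 ^ l))\<^sup>2"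
    by (simp add: power_mult[symmetric] mult.commute)
  also have "\<dots> = (1 + fps_X ^ (2 ^ l))\<^sup>2"
    by (simp only: Suc.IH)
  also have "\<dots> = 1 + fps_X ^ (2 ^ Suc l)"
    by (simp add: power2_sum bit_fps_two_eq_0 power_mult[symmetric] mult.commute)
  finally show ?case .
qed simp

text \<open>The reflection \<open>i \<mapsto> n - i\<close> pairs the off-diagonal terms, which
  cancel in characteristic 2. Only the diagonal term \<open>i = n div 2\<close> can survive, and
  \<open>x * x = x\<close> in \<open>bit\<close>.\<close>

lemma bit_fps_power2_nth:
  "((G :: bit fps)\<^sup>2) $ n = (if even n then G $ (n div 2) else 0)"
proof -
  let ?g = "\<lambda>i. G $ i * G $ (n - i)"
  have "(G\<^sup>2) $ n = sum ?g {0..n}"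
    by (simp add: power2_eq_square fps_mult_nth)
  also have "{0..n} = ({i. 2 * i < n} \<union> {i. n < 2 * i \<and> i \<le> n}) \<union> {i. 2 * i = n}"
    by auto
  also have "sum ?g \<dots> = sum ?g {i. 2 * i < n} + sum ?g {i. n < 2 * i \<and> i \<le> n} + sum ?g {i. 2 * i = n}"
  proof -
    have "finite {i. 2 * i < n}" "finite {i. n < 2 * i \<and> i \<le> n}" "finite {i. 2 * i = n}"
      by (auto intro: finite_subset[of _ "{..n}"])
    then show ?thesis
      by (subst sum.union_disjoint; (subst sum.union_disjoint)?) auto
  qed
  also have "sum ?g {i. n < 2 * i \<and> i \<le> n} = sum ?g {i. 2 * i < n}"
    by (rule sum.reindex_bij_witness[of _ "\<lambda>i. n - i" "\<lambda>i. n - i"]) (auto simp: mult.commute)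
  also have "sum ?g {i. 2 * i = n} = (if even n then G $ (n div 2) else 0)"
  proof (cases "even n")
    case True
    then obtain m where "n = 2 * m" ..
    moreover have "x * x = x" for x :: bit
      by (cases x) auto
    ultimately show ?thesis
      by simp
  next
    case False
    then have "{i. 2 * i = n} = {}"
      by auto
    with False show ?thesis
      by (simp only: sum.empty if_False)
  qed
  finally show ?thesis
    by simp
qed

lemma eval_h_poly:
  "eval_at_fps (h_poly l a1 a0 f) G =
     (1 + fps_X) ^ (2 ^ l) * ((fps_const a1 * fps_X + fps_const a0) * G\<^sup>2 + G) + fps_of_poly f"
proof -
  have "[:[:0, 1:]:] + 1 = [:[:1, 1 :: bit:]:]"
    by (simp add: one_pCons)
  then have "h_poly l a1 a0 f = [:f, [:1, 1:] ^ (2 ^ l), [:1, 1:] ^ (2 ^ l) * [:a0, a1:]:]"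
    by (simp add: h_poly_def Let_def poly_const_pow power2_eq_square)
  then show ?thesis
    by (simp add: eval_at_fps_def map_poly_pCons fps_of_poly_add fps_of_poly_smult fps_of_poly_power
        fps_of_poly_pCons algebra_simps power2_eq_square)
qed

lemma recurrence_of_equation:
  assumes "degree f \<le> 2 ^ l - 1"
    and "eval_at_fps (h_poly l a1 a0 f) (Abs_fps s) = 0"
  obtains t where "\<And>n. t (n + 2 ^ l) = t n"
    and "\<And>m. s (2 * m) = t (2 * m) + a0 * s m"
    and "\<And>m. s (2 * m + 1) = t (2 * m + 1) + a1 * s m"
proof
  define T where "T = (fps_const a1 * fps_X + fps_const a0) * (Abs_fps s)\<^sup>2 + Abs_fps s"
  have eq: "(1 + fps_X ^ (2 ^ l)) * T + fps_of_poly f = 0"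
    using assms(2) by (simp add: eval_h_poly T_def bit_fps_one_plus_X_power)
  show "T $ (n + 2 ^ l) = T $ n" for n
  proof -
    \<comment> \<open>From index \<open>2 ^ l\<close> on, \<open>f\<close> contributes nothing, so
      the coefficient of the equation there relates only \<open>T $ (n + 2 ^ l)\<close> and
      \<open>T $ n\<close>.\<close>
    have "degree f < n + 2 ^ l"
      using assms(1) by (simp add: le_less_trans trans_less_add2)
    moreover have "((1 + fps_X ^ (2 ^ l)) * T + fps_of_poly f) $ (n + 2 ^ l) = 0"
      using eq by simp
    ultimately have "T $ (n + 2 ^ l) + T $ n = 0"
      by (simp add: distrib_right fps_X_power_mult_nth coeff_eq_0)
    then show ?thesis
      by (cases "T $ (n + 2 ^ l)"; cases "T $ n") simp_all
  qed
  \<comment> \<open>As \<open>G\<^sup>2\<close> has only even exponents, the \<open>a0\<close> term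
    acts at even indices and the \<open>a1\<close> term, shifted by \<open>fps_X\<close>, at odd
    ones.\<close>
  have nth: "T $ n = a1 * (if n = 0 then 0 else ((Abs_fps s)\<^sup>2) $ (n - 1)) + a0 * ((Abs_fps s)\<^sup>2) $ n + s n"
    for n
    by (simp add: T_def distrib_right mult.assoc)
  show "s (2 * m) = T $ (2 * m) + a0 * s m" for m
    unfolding nth by (auto simp: bit_fps_power2_nth add.assoc[symmetric])
  show "s (2 * m + 1) = T $ (2 * m + 1) + a1 * s m" for m
    unfolding nth by (auto simp: bit_fps_power2_nth add.assoc[symmetric])
qed

subsection \<open>Lower bounds for the correlation measure\<close>

lemma correlation_sum_le:
  assumes "d1 < d2" "d2 + M < N"
  shows "\<bar>\<Sum>n = 0..M. (-1) ^ of_bit (s (n + d1) + s (n + d2))\<bar> \<le> correlation_measure2 s N"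
  unfolding correlation_measure2_def
proof (rule Max_ge)
  let ?F = "\<lambda>(M, d1, d2). \<bar>\<Sum>n = 0..M. (-1) ^ of_bit (s (n + d1) + s (n + d2)) :: int\<bar>"
  show "finite {\<bar>\<Sum>n = 0..M. (-1) ^ of_bit (s (n + d1) + s (n + d2)) :: int\<bar> | M d1 d2.
            d1 < d2 \<and> d2 + M < N}"
    by (rule finite_subset[of _ "?F ` ({..N} \<times> {..N} \<times> {..N})"]) (force simp: image_iff)+
qed (use assms in blast)

text \<open>The terms outside \<open>E\<close> share one sign and add up to
  \<open>card A - card E\<close> in absolute value; those in \<open>E\<close> can cancel at most
  \<open>card E\<close> of that.\<close>

lemma sum_minus_one_power_ge:
  fixes b :: "'a \<Rightarrow> bit"
  assumes "finite A" "E \<subseteq> A" "\<And>n. n \<in> A - E \<Longrightarrow> b n = c"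
  shows "int (card A) - 2 * int (card E) \<le> \<bar>\<Sum>n\<in>A. (-1) ^ of_bit (b n)\<bar>"
proof -
  let ?g = "\<lambda>n. (-1) ^ of_bit (b n) :: int"
  have E: "finite E"
    using assms finite_subset by blast
  have "sum ?g A = sum ?g (A - E) + sum ?g E"
    using assms by (simp add: sum.subset_diff)
  moreover have "sum ?g (A - E) = (-1) ^ of_bit c * (int (card A) - int (card E))"
    using assms E by (simp add: card_Diff_subset card_mono of_nat_diff)
  moreover have "\<bar>sum ?g E\<bar> \<le> int (card E)"
    using sum_abs[of ?g E] by (simp add: power_abs)
  moreover have "int (card E) \<le> int (card A)"
    using assms card_mono by auto
  ultimately show ?thesis
    by (cases c) auto
qed

lemma correlation_measure2_ge:
  assumes "d1 < d2" "d2 + L \<le> N" "0 < L"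
    and "E \<subseteq> {..<L}" "\<And>n. n < L \<Longrightarrow> n \<notin> E \<Longrightarrow> s (n + d1) + s (n + d2) = c"
  shows "int L - 2 * int (card E) \<le> correlation_measure2 s N"
proof -
  have L: "{0..L - 1} = {..<L}"
    using assms(3) by auto
  have "int L - 2 * int (card E)
      \<le> \<bar>\<Sum>n = 0..L - 1. (-1) ^ of_bit (s (n + d1) + s (n + d2))\<bar>"
    using sum_minus_one_power_ge[of "{..<L}" E "\<lambda>n. s (n + d1) + s (n + d2)" c] assms(4,5)
    unfolding L by simp
  also have "\<dots> \<le> correlation_measure2 s N"
    using assms by (intro correlation_sum_le) auto
  finally show ?thesis .
qed

subsection \<open>Difference sequences\<close>

lemma difference_doubling:
  fixes s t :: "nat \<Rightarrow> bit"
  assumes "\<And>n. t (n + 2 * d) = t n"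
    and "\<And>m. s (2 * m) = t (2 * m) + a0 * s m"
    and "\<And>m. s (2 * m + 1) = t (2 * m + 1) + a1 * s m"
  shows "s n + s (n + 2 * d) = (if even n then a0 else a1) * (s (n div 2) + s (n div 2 + d))"
proof -
  obtain m where m: "n = 2 * m \<or> n = 2 * m + 1"
    by (metis oddE evenE)
  have *: "(x + a * y) + (x + a * z) = a * (y + z)" for x y z a :: bit
    by (cases x; cases a; cases y; cases z) simp_all
  have "2 * m + 2 * d = 2 * (m + d)" "2 * m + 1 + 2 * d = 2 * (m + d) + 1"
    by simp_all
  then show ?thesis
    using m assms(1)[of n] by (auto simp only: assms(2,3) * ) (simp_all add: *)
qed

lemma difference_almost_constant:
  fixes s t :: "nat \<Rightarrow> bit"
  assumes per: "\<And>n. t (n + 2 * h) = t n"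
    and rec: "\<And>m. s (2 * m) = t (2 * m) + a0 * s m"
      "\<And>m. s (2 * m + 1) = t (2 * m + 1) + a1 * s m"
  obtains e c where "\<And>n. n < 2 ^ j \<Longrightarrow> n \<noteq> e \<Longrightarrow> s n + s (n + 2 ^ j * h) = c"
proof -
  have periods: "t (n + i * (2 * h)) = t n" for n i
  proof (induction i)
    case (Suc i)
    then show ?case
      using per[of "n + i * (2 * h)"] by (simp add: algebra_simps)
  qed simp
  \<comment> \<open>Doubling applies with \<open>d = 2 ^ j * h\<close>, because \<open>2 * d\<close>
    is a multiple of the period \<open>2 * h\<close>.\<close>
  have step: "s n + s (n + 2 ^ Suc j * h)
      = (if even n then a0 else a1) * (s (n div 2) + s (n div 2 + 2 ^ j * h))" for j n
    using difference_doubling[of t "2 ^ j * h" s a0 a1 n] periods[of _ "2 ^ j"] rec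
    by (simp add: algebra_simps)
  show ?thesis
  proof (cases "a0 = 1 \<and> a1 = 1")
    case True
    have "s n + s (n + 2 ^ j * h) = s 0 + s h" if "n < 2 ^ j" for n
      using that
    proof (induction j arbitrary: n)
      case (Suc j)
      then have "n div 2 < 2 ^ j"
        by auto
      from Suc.IH[OF this] show ?case
        using True by (simp only: step if_cancel mult_1_left)
    qed simp
    then show ?thesis
      using that by blast
  next
    case False
    \<comment> \<open>Some \<open>a_b\<close> is 0 here. Of the two children \<open>2 * e\<close>
      and \<open>2 * e + 1\<close> of the exception, at most the one with factor 1 stays
      exceptional. For \<open>j = 0\<close> the only index is 0.\<close>
    have "\<exists>e. \<forall>n < 2 ^ j. n \<noteq> e \<longrightarrow> s n + s (n + 2 ^ j * h) = 0"
    proof (induction j)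
      case (Suc j)
      then obtain e where e: "s n + s (n + 2 ^ j * h) = 0" if "n < 2 ^ j" "n \<noteq> e" for n
        by blast
      have "s n + s (n + 2 ^ Suc j * h) = 0"
        if n: "n < 2 ^ Suc j" "n \<noteq> 2 * e + (if a0 = 1 then 0 else 1)" for n
      proof (cases "n div 2 = e")
        case True
        then have "(if even n then a0 else a1) = 0"
          using n(2) False by (cases a0; cases a1; cases "even n") (auto elim!: evenE oddE)
        then show ?thesis
          by (simp only: step mult_zero_left)
      next
        case False
        have "n div 2 < 2 ^ j"
          using n(1) by auto
        from e[OF this False] show ?thesis
          by (simp only: step mult_zero_right)
      qed
      then show ?case
        by blast
    qed auto
    then show ?thesis
      using that by blast
  qed
qed

lemma dyadic_interval:
  fixes b N :: nat
  assumes "0 < b" "b \<le> N"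
  obtains k where "2 ^ k * b \<le> N" "N < 2 ^ Suc k * b"
proof -
  have pos: "0 < N div b"
    using assms by (simp add: div_greater_zero_iff)
  obtain k where k: "2 ^ k \<le> N div b" "N div b < 2 ^ (k + 1)"
    using ex_power_ivl1[of 2 "N div b"] pos by auto
  show ?thesis
  proof
    show "2 ^ k * b \<le> N"
      using k(1) assms(1) by (simp add: less_eq_div_iff_mult_less_eq)
    show "N < 2 ^ Suc k * b"
      using k(2) assms(1) by (simp add: div_less_iff_less_mult)
  qed
qed

subsection \<open>The bound\<close>

lemma correlation_measure2_bound_even_period:
  fixes s t :: "nat \<Rightarrow> bit"
  assumes "\<And>n. t (n + 2 * h) = t n"
    and "\<And>m. s (2 * m) = t (2 * m) + a0 * s m"
    and "\<And>m. s (2 * m + 1) = t (2 * m + 1) + a1 * s m"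
    and "0 < h" "2 * h + 2 \<le> N"
  shows "real_of_int (correlation_measure2 s N) > real N / (2 * h + 2) - 2"
proof -
  obtain k where k: "2 ^ k * (2 * h + 2) \<le> N" "N < 2 ^ Suc k * (2 * h + 2)"
    using dyadic_interval[of "2 * h + 2" N] assms(5) by auto
  \<comment> \<open>With this exponent, shift plus window length is
    \<open>2 ^ ?j * (h + 1) = 2 ^ k * (2 * h + 2)\<close>, which is at most
    \<open>N\<close>.\<close>
  let ?j = "Suc k"
  obtain e c where ec: "\<And>n. n < 2 ^ ?j \<Longrightarrow> n \<noteq> e \<Longrightarrow> s n + s (n + 2 ^ ?j * h) = c"
    using difference_almost_constant[OF assms(1-3)] by blast
  have "int (2 ^ ?j) - 2 * int (card ({e} \<inter> {..<2 ^ ?j})) \<le> correlation_measure2 s N"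
  proof (rule correlation_measure2_ge[where ?d1.0 = 0 and ?d2.0 = "2 ^ ?j * h" and c = c])
    show "2 ^ ?j * h + 2 ^ ?j \<le> N"
      using k(1) by (simp add: algebra_simps)
  qed (use assms(4) ec in auto)
  moreover have "card ({e} \<inter> {..<2 ^ ?j}) \<le> 1"
    using card_mono[of "{e}" "{e} \<inter> {..<2 ^ ?j}"] by simp
  ultimately have "2 ^ ?j - 2 \<le> correlation_measure2 s N"
    by simp
  then have "real_of_int (2 ^ ?j - 2) \<le> real_of_int (correlation_measure2 s N)"
    by (simp only: of_int_le_iff)
  moreover have "real N < real (2 ^ ?j * (2 * h + 2))"
    using k(2) by (simp only: of_nat_less_iff)
  then have "real N / (2 * h + 2) < 2 ^ ?j"
    by (simp add: pos_divide_less_eq algebra_simps)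
  ultimately show ?thesis
    by simp
qed

text \<open>Each counted \<open>n\<close> is the last element of a block of four consecutive numbers
  lying entirely below \<open>L\<close>.\<close>

lemma card_mod_4_eq_3_le: "4 * card {n. n < L \<and> n mod 4 = (3 :: nat)} \<le> L"
proof -
  have "{n. n < L \<and> n mod 4 = 3} \<subseteq> (\<lambda>i. 4 * i + 3) ` {..<L div 4}"
  proof
    fix n assume "n \<in> {n. n < L \<and> n mod 4 = 3}"
    then have "n mod 4 = 3" "n < L"
      by simp_all
    moreover from this have "n = 4 * (n div 4) + 3"
      using mult_div_mod_eq[of 4 n] by simp
    ultimately have "n = 4 * (n div 4) + 3" "n div 4 < L div 4"
      using less_eq_div_iff_mult_less_eq[of 4 "Suc (n div 4)" L] by simp_all
    then show "n \<in> (\<lambda>i. 4 * i + 3) ` {..<L div 4}"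
      by blast
  qed
  then have "card {n. n < L \<and> n mod 4 = 3} \<le> L div 4"
    using surj_card_le[of "{..<L div 4}"] by simp
  then show ?thesis
    by simp
qed

lemma correlation_measure2_bound_constant:
  fixes s :: "nat \<Rightarrow> bit" and c :: bit
  assumes rec: "\<And>m. s (2 * m) = c + a0 * s m" "\<And>m. s (2 * m + 1) = c + a1 * s m"
    and nz: "(a1, a0) \<noteq> (0, 0)" and N: "6 \<le> N"
  shows "real_of_int (correlation_measure2 s N) > real N / 3 - 2"
proof (cases "a0 = 1")
  case True
  \<comment> \<open>At \<open>m = 0\<close> the even recurrence reads
    \<open>s 0 = c + s 0\<close>.\<close>
  have "c = 0"
    using rec(1)[of 0] True by (cases c) (auto, (cases "s 0", auto)?)
  have const: "s n = s 1" if "0 < n" for n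
    using that
  proof (induction n rule: less_induct)
    case (less n)
    have 1: "s 1 = a1 * s 0"
      using rec(2)[of 0] \<open>c = 0\<close> by simp
    show ?case
    proof (cases "even n")
      case True
      then obtain m where m: "n = 2 * m" ..
      then have "s m = s 1"
        using less(1)[of m] less(2) by auto
      then show ?thesis
        using rec(1)[of m] m \<open>c = 0\<close> \<open>a0 = 1\<close> by simp
    next
      case False
      then obtain m where m: "n = 2 * m + 1" ..
      have "s n = a1 * s m"
        using rec(2)[of m] \<open>c = 0\<close> m by simp
      moreover have "m = 0 \<or> s m = s 1"
        using less(1)[of m] m by auto
      ultimately show ?thesis
        using 1 by (cases a1) auto
    qed
  qed
  \<comment> \<open>The window starts at index 1 since \<open>s 0\<close> may differ from the later
    values.\<close>
  have "int (N - 2) - 2 * int (card ({} :: nat set)) \<le> correlation_measure2 s N"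
  proof (rule correlation_measure2_ge[where ?d1.0 = 1 and ?d2.0 = 2 and c = 0])
    show "s (n + 1) + s (n + 2) = 0" for n
      using const[of "n + 1"] const[of "n + 2"] by simp
  qed (use N in auto)
  then have "int N - 2 \<le> correlation_measure2 s N"
    using N by simp
  then have "real_of_int (int N - 2) \<le> real_of_int (correlation_measure2 s N)"
    by (simp only: of_int_le_iff)
  then show ?thesis
    using N by simp
next
  case False
  then have a: "a0 = 0" "a1 = 1"
    using nz by (cases a0; cases a1; simp)+
  have step: "s n + s (n + 2 * d) = (if even n then 0 else s (n div 2) + s (n div 2 + d))" for n d
    using difference_doubling[of "\<lambda>_. c" d s a0 a1 n] rec a by simp
  \<comment> \<open>Two doublings from shift 1 reach shift 4. The difference can be nonzero only if
    \<open>n\<close> and \<open>n div 2\<close> are both odd. At most a quarter of the window is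
    exceptional, which leaves \<open>(N - 4) / 2 = N / 2 - 2\<close>.\<close>
  let ?E = "{n. n < N - 4 \<and> n mod 4 = 3}"
  have "int (N - 4) - 2 * int (card ?E) \<le> correlation_measure2 s N"
  proof (rule correlation_measure2_ge[where ?d1.0 = 0 and ?d2.0 = 4 and c = 0])
    fix n assume "n < N - 4" "n \<notin> ?E"
    then have "even n \<or> even (n div 2)"
      by simp presburger
    then show "s (n + 0) + s (n + 4) = 0"
      using step[of n 2] step[of "n div 2" 1] by auto
  qed (use N in auto)
  moreover have "4 * int (card ?E) \<le> int (N - 4)"
    using card_mod_4_eq_3_le[of "N - 4"] by linarith
  ultimately have "int N - 4 \<le> 2 * correlation_measure2 s N"
    using N by linarith
  then have "real_of_int (int N - 4) \<le> real_of_int (2 * correlation_measure2 s N)"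
    by (simp only: of_int_le_iff)
  then show ?thesis
    using N by simp
qed

theorem theorem2:
  fixes s :: "nat \<Rightarrow> bit" and l :: nat and f :: "bit poly" and a0 a1 :: bit
  assumes "degree f \<le> 2 ^ l - 1"
    and "(a1, a0) \<noteq> (0, 0)"
    and "eval_at_fps (h_poly l a1 a0 f) (Abs_fps s) = 0"
  shows "\<forall>N::nat. N \<ge> 2 ^ (l + 1) + 4 \<longrightarrow>
           real_of_int (correlation_measure2 s N) > real N / (2 ^ l + 2) - 2"
proof (intro allI impI)
  fix N :: nat
  assume N: "N \<ge> 2 ^ (l + 1) + 4"
  obtain t where t: "\<And>n. t (n + 2 ^ l) = t n"
    "\<And>m. s (2 * m) = t (2 * m) + a0 * s m" "\<And>m. s (2 * m + 1) = t (2 * m + 1) + a1 * s m"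
    using recurrence_of_equation[OF assms(1,3)] by blast
  show "real_of_int (correlation_measure2 s N) > real N / (2 ^ l + 2) - 2"
  proof (cases l)
    case 0
    have "t n = t 0" for n
      using t(1) 0 by (induction n) simp_all
    then have "s (2 * m) = t 0 + a0 * s m" "s (2 * m + 1) = t 0 + a1 * s m" for m
      using t(2,3)[of m] by metis+
    then show ?thesis
      using correlation_measure2_bound_constant[of s "t 0" a0 a1 N] assms(2) N 0 by simp
  next
    case (Suc k)
    have "real_of_int (correlation_measure2 s N) > real N / real (2 * 2 ^ k + 2) - 2"
    proof (rule correlation_measure2_bound_even_period)
      show "t (n + 2 * 2 ^ k) = t n" for n
        using t(1)[of n] Suc by simp
      show "2 * 2 ^ k + 2 \<le> N"
        using N Suc by simp
    qed (fact t(2) t(3) | simp)+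
    then show ?thesis
      using Suc by (simp add: add.commute)
  qed
qed

end
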